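(* Let $f:\mathbb{R}^n\to\mathbb{R}$ be continuously differentiable, bounded below with infimum $f_{\rm low}$, and $(\alpha,L_0,L_1)$-smooth for some $\alpha\in[0,1]$ and $L_0,L_1\ge 0$ (not both zero). Let the trust-region algorithm described in the context be applied to $f$, and assume there are $b_0,b_1\ge 0$ with $L_0\ge b_0$, $L_1\ge b_1$ such that $\|B_k\|\le b_0+b_1\|\nabla f(x_k)\|^\alpha$ for all $k\in\mathbb{N}$. Assume that the algorithm generates infinitely many successful iterations. Let $0<\epsilon<1$ with $\|\nabla f(x_0)\|>\epsilon$, let $k_\epsilon$ be the first iteration such that $\|\nabla f(x_{k_\epsilon})\|>\epsilon$ and $\|\nabla f(x_{k_\epsilon+1})\|\le\epsilon$, and let $\mathcal{S}(\epsilon)$ be the set of successful iterations $k$ with $k<k_\epsilon$. Define $$\kappa_0=\frac{f(x_0)-f_{\rm low}}{\eta_1\kappa_{\rm mdc}^2(1-\eta_2)\theta_{\min}}.$$ Then $$|\mathcal{S}(\epsilon)|\le L_1\bigl(1+(\kappa_{\rm mdc}(1-\eta_2))^\alpha\bigr)\kappa_0\,\epsilon^{\alpha-2}+L_0\,\kappa_0\,\epsilon^{-2}.$$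
   Context: Convention: $0^0=1$; $\|\cdot\|$ is the Euclidean norm and its induced matrix norm. Smoothness. A continuously differentiable $f$ is $(\alpha,L_0,L_1)$-smooth (with $L_0>0$ or $L_1>0$) if for all $x,y\in\mathbb{R}^n$, $\|\nabla f(x)-\nabla f(y)\|\le\bigl(L_0+L_1\int_0^1\|\nabla f(x+t(y-x))\|^\alpha dt\bigr)\|x-y\|$. Trust-region algorithm. Constants: $\kappa_{\rm mdc}\in(0,\frac12]$, $0<\eta_1\le\eta_2<1$, $0<\gamma_1\le\gamma_2<1\le\gamma_3$, $x_0\in\mathbb{R}^n$, $\Delta_0>0$. For $k=0,1,\dots$: choose a symmetric $B_k\in\mathbb{R}^{n\times n}$ and let $m_k(s)=f(x_k)+\nabla f(x_k)^Ts+\frac12s^TB_ks$; compute any $s_k$ with $\|s_k\|\le\Delta_k$ and $m_k(0)-m_k(s_k)\ge\kappa_{\rm mdc}\|\nabla f(x_k)\|\min\{\|\nabla f(x_k)\|/\|B_k\|,\Delta_k\}$ (with $\|\nabla f(x_k)\|/\|B_k\|=+\infty$ if $B_k=0$); set $\rho_k=\frac{f(x_k)-f(x_k+s_k)}{m_k(0)-m_k(s_k)}$; set $x_{k+1}=x_k+s_k$ if $\rho_k\ge\eta_1$ (successful iteration), and $x_{k+1}=x_k$ otherwise; choose $\Delta_{k+1}\in[\Delta_k,\gamma_3\Delta_k]$ if $\rho_k\ge\eta_2$, $\Delta_{k+1}\in[\gamma_2\Delta_k,\Delta_k]$ if $\eta_1\le\rho_k<\eta_2$, and $\Delta_{k+1}\in[\gamma_1\Delta_k,\gamma_2\Delta_k]$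 if $\rho_k<\eta_1$. Auxiliary functions. For $a\ge0,b>0$: $g(a,b)=\Bigl(1+\frac{(1-\alpha)L_1a^\alpha}{(L_0+L_1b^\alpha)^{1-\alpha}}\Bigr)^{1/(1-\alpha)}$ if $\alpha\in[0,1)$, and $g(a,b)=\exp(L_1a)$ if $\alpha=1$. For $b,t>0$, $h(b,t)$ is the unique $a>0$ with $a\,g(a,b)=t$. For $t>0$, $\psi(t)=\frac{t}{L_0+L_1t^\alpha}$. Finally $$\theta_{\min}=\gamma_1\min\Bigl\{1,\frac{\Delta_0}{h(\|\nabla f(x_0)\|,\kappa_{\rm mdc}(1-\eta_2)\psi(\|\nabla f(x_0)\|))}\Bigr\}.$$ *)

theory Defs
  imports "HOL-Analysis.Analysis"
begin

text \<open>In the library \<open>0 powr 0 = 0\<close>; the convention used here is \<open>0\<^sup>0 = 1\<close>.\<close>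

definition rpow :: "real \<Rightarrow> real \<Rightarrow> real" where
  "rpow a p = (if p = 0 then 1 else a powr p)"

definition grad :: "(real ^ 'n \<Rightarrow> real) \<Rightarrow> real ^ 'n \<Rightarrow> real ^ 'n" where
  "grad f x = (THE D. GDERIV f x :> D)"

definition C1 :: "(real ^ 'n \<Rightarrow> real) \<Rightarrow> bool" where
  "C1 f \<longleftrightarrow> (\<forall>x. f differentiable (at x)) \<and> continuous_on UNIV (grad f)"

definition matrix_norm :: "real ^ 'n ^ 'n \<Rightarrow> real" where
  "matrix_norm B = onorm (\<lambda>v. B *v v)"

definition alpha_smooth :: "real \<Rightarrow> real \<Rightarrow> real \<Rightarrow> (real ^ 'n \<Rightarrow> real) \<Rightarrow> bool" where
  "alpha_smooth \<alpha> L0 L1 f \<longleftrightarrow>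
     (\<forall>x y. norm (grad f x - grad f y)
        \<le> (L0 + L1 * integral {0..1} (\<lambda>t. rpow (norm (grad f (x + t *\<^sub>R (y - x)))) \<alpha>))
            * norm (x - y))"

subsection \<open>The trust-region algorithm\<close>

definition tr_constants :: "real \<Rightarrow> real \<Rightarrow> real \<Rightarrow> real \<Rightarrow> real \<Rightarrow> real \<Rightarrow> bool" where
  "tr_constants \<kappa> \<eta>1 \<eta>2 \<gamma>1 \<gamma>2 \<gamma>3 \<longleftrightarrow>
     0 < \<kappa> \<and> \<kappa> \<le> 1/2 \<and> 0 < \<eta>1 \<and> \<eta>1 \<le> \<eta>2 \<and> \<eta>2 < 1 \<and>
     0 < \<gamma>1 \<and> \<gamma>1 \<le> \<gamma>2 \<and> \<gamma>2 < 1 \<and> 1 \<le> \<gamma>3"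

definition model :: "(real ^ 'n \<Rightarrow> real) \<Rightarrow> real ^ 'n \<Rightarrow> real ^ 'n ^ 'n \<Rightarrow> real ^ 'n \<Rightarrow> real" where
  "model f x B s = f x + grad f x \<bullet> s + 1/2 * (s \<bullet> (B *v s))"

definition model_decrease ::
  "(real ^ 'n \<Rightarrow> real) \<Rightarrow> real ^ 'n \<Rightarrow> real ^ 'n ^ 'n \<Rightarrow> real ^ 'n \<Rightarrow> real" where
  "model_decrease f x B s = model f x B 0 - model f x B s"

text \<open>The case \<open>B = 0\<close> encodes that the quotient by the norm of \<open>B\<close> is then infinite.\<close>

definition admissible_step ::
  "(real ^ 'n \<Rightarrow> real) \<Rightarrow> real \<Rightarrow> real ^ 'n \<Rightarrow> real ^ 'n ^ 'n \<Rightarrow> real \<Rightarrow> real ^ 'n \<Rightarrow> bool" where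
  "admissible_step f \<kappa> x B \<Delta> s \<longleftrightarrow>
     norm s \<le> \<Delta> \<and>
     model_decrease f x B s \<ge> \<kappa> * norm (grad f x) *
       (if B = 0 then \<Delta> else min (norm (grad f x) / matrix_norm B) \<Delta>)"

text \<open>The model decrease can only vanish at an admissible step if the gradient vanishes (for a
  positive radius). In that degenerate case the quotient is \<open>0\<close> and the iteration is
  unsuccessful.\<close>

definition tr_ratio ::
  "(real ^ 'n \<Rightarrow> real) \<Rightarrow> real ^ 'n \<Rightarrow> real ^ 'n ^ 'n \<Rightarrow> real ^ 'n \<Rightarrow> real" where
  "tr_ratio f x B s = (f x - f (x + s)) / model_decrease f x B s"

definition successful ::
  "(real ^ 'n \<Rightarrow> real) \<Rightarrow> real \<Rightarrow> (nat \<Rightarrow> real ^ 'n) \<Rightarrow> (nat \<Rightarrow> real ^ 'n ^ 'n) \<Rightarrow>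
   (nat \<Rightarrow> real ^ 'n) \<Rightarrow> nat \<Rightarrow> bool" where
  "successful f \<eta>1 x B s k \<longleftrightarrow> tr_ratio f (x k) (B k) (s k) \<ge> \<eta>1"

text \<open>The algorithm makes free choices, so it is a predicate on the generated sequences of
  iterates, radii, model Hessians and steps.\<close>

definition tr_run ::
  "(real ^ 'n \<Rightarrow> real) \<Rightarrow> real \<Rightarrow> real \<Rightarrow> real \<Rightarrow> real \<Rightarrow> real \<Rightarrow> real \<Rightarrow> real ^ 'n \<Rightarrow> real \<Rightarrow>
   (nat \<Rightarrow> real ^ 'n) \<Rightarrow> (nat \<Rightarrow> real) \<Rightarrow> (nat \<Rightarrow> real ^ 'n ^ 'n) \<Rightarrow> (nat \<Rightarrow> real ^ 'n) \<Rightarrow> bool"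
where
  "tr_run f \<kappa> \<eta>1 \<eta>2 \<gamma>1 \<gamma>2 \<gamma>3 x0 \<Delta>0 x \<Delta> B s \<longleftrightarrow>
     x 0 = x0 \<and> \<Delta> 0 = \<Delta>0 \<and>
     (\<forall>k. transpose (B k) = B k \<and>
          admissible_step f \<kappa> (x k) (B k) (\<Delta> k) (s k) \<and>
          x (Suc k) = (if successful f \<eta>1 x B s k then x k + s k else x k) \<and>
          (let \<rho> = tr_ratio f (x k) (B k) (s k) in
             if \<rho> \<ge> \<eta>2 then \<Delta> (Suc k) \<in> {\<Delta> k .. \<gamma>3 * \<Delta> k}
             else if \<rho> \<ge> \<eta>1 then \<Delta> (Suc k) \<in> {\<gamma>2 * \<Delta> k .. \<Delta> k}
             else \<Delta> (Suc k) \<in> {\<gamma>1 * \<Delta> k .. \<gamma>2 * \<Delta> k}))"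

subsection \<open>Auxiliary functions\<close>

definition aux_g :: "real \<Rightarrow> real \<Rightarrow> real \<Rightarrow> real \<Rightarrow> real \<Rightarrow> real" where
  "aux_g \<alpha> L0 L1 a b =
     (if \<alpha> = 1 then exp (L1 * a)
      else (1 + (1 - \<alpha>) * L1 * rpow a \<alpha> / (L0 + L1 * rpow b \<alpha>) powr (1 - \<alpha>))
             powr (1 / (1 - \<alpha>)))"

definition aux_h :: "real \<Rightarrow> real \<Rightarrow> real \<Rightarrow> real \<Rightarrow> real \<Rightarrow> real" where
  "aux_h \<alpha> L0 L1 b t = (THE a. a > 0 \<and> a * aux_g \<alpha> L0 L1 a b = t)"

definition aux_psi :: "real \<Rightarrow> real \<Rightarrow> real \<Rightarrow> real \<Rightarrow> real" where
  "aux_psi \<alpha> L0 L1 t = t / (L0 + L1 * rpow t \<alpha>)"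

definition theta_min ::
  "real \<Rightarrow> real \<Rightarrow> real \<Rightarrow> (real ^ 'n \<Rightarrow> real) \<Rightarrow> real \<Rightarrow> real \<Rightarrow> real \<Rightarrow> real ^ 'n \<Rightarrow> real \<Rightarrow> real"
where
  "theta_min \<alpha> L0 L1 f \<kappa> \<eta>2 \<gamma>1 x0 \<Delta>0 =
     \<gamma>1 * min 1 (\<Delta>0 / aux_h \<alpha> L0 L1 (norm (grad f x0))
                        (\<kappa> * (1 - \<eta>2) * aux_psi \<alpha> L0 L1 (norm (grad f x0))))"

subsection \<open>Iterations before the gradient threshold\<close>

definition crosses :: "(real ^ 'n \<Rightarrow> real) \<Rightarrow> (nat \<Rightarrow> real ^ 'n) \<Rightarrow> real \<Rightarrow> nat \<Rightarrow> bool" where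
  "crosses f x \<epsilon> k \<longleftrightarrow> norm (grad f (x k)) > \<epsilon> \<and> norm (grad f (x (Suc k))) \<le> \<epsilon>"

definition k_first :: "(real ^ 'n \<Rightarrow> real) \<Rightarrow> (nat \<Rightarrow> real ^ 'n) \<Rightarrow> real \<Rightarrow> nat" where
  "k_first f x \<epsilon> = (LEAST k. crosses f x \<epsilon> k)"

definition successful_before ::
  "(real ^ 'n \<Rightarrow> real) \<Rightarrow> real \<Rightarrow> (nat \<Rightarrow> real ^ 'n) \<Rightarrow> (nat \<Rightarrow> real ^ 'n ^ 'n) \<Rightarrow>
   (nat \<Rightarrow> real ^ 'n) \<Rightarrow> real \<Rightarrow> nat set" where
  "successful_before f \<eta>1 x B s \<epsilon> = {k. k < k_first f x \<epsilon> \<and> successful f \<eta>1 x B s k}"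

end

theory Submission imports Defs
begin

text \<open>Along a segment of length \<open>a\<close> starting where the gradient has norm \<open>b\<close>, the smoothness
  condition is an integral inequality for the gradient displacement. Comparing it with the equation
  \<open>y' = c y\<^sup>\<alpha>\<close> bounds the displacement by \<open>(L0 + L1 b\<^sup>\<alpha>) a g(a, b)\<close>. Hence an iteration is very
  successful as soon as \<open>\<Delta> g(\<Delta>, b) \<le> \<kappa> (1 - \<eta>2) \<psi>(b)\<close>. Since \<open>\<psi>\<close> is increasing and \<open>g\<close> decreases in
  its second argument, the one radius
  \<open>r = c \<epsilon> / (L0 + L1 (1 + c\<^sup>\<alpha>) \<epsilon>\<^sup>\<alpha>)\<close>, with \<open>c = \<kappa> (1 - \<eta>2)\<close>, has this property at every point whose
  gradient norm exceeds \<open>\<epsilon>\<close>; there the radii therefore stay above \<open>\<theta>\<^sub>m\<^sub>i\<^sub>n r\<close>, and every successful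
  iteration decreases \<open>f\<close> by at least \<open>\<eta>1 \<kappa> \<epsilon> \<theta>\<^sub>m\<^sub>i\<^sub>n r\<close>.\<close>

subsection \<open>A nonlinear Gronwall inequality\<close>

lemma rpow_pos [simp]: "0 < a \<Longrightarrow> rpow a p = a powr p"
  by (simp add: rpow_def)

lemma rpow_nonneg [simp]: "0 \<le> rpow a p"
  by (simp add: rpow_def)

lemma rpow_mono: "\<lbrakk>0 \<le> p; 0 \<le> a; a \<le> b\<rbrakk> \<Longrightarrow> rpow a p \<le> rpow b p"
  by (simp add: rpow_def powr_mono2)

lemma rpow_mult: "rpow (a * b) p = rpow a p * rpow b p"
  by (simp add: rpow_def powr_mult)

text \<open>Both fractions \<open>a / (a + b)\<close> and \<open>b / (a + b)\<close> lie in the unit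
  interval, so raising them to a power \<open>p \<le> 1\<close> does not decrease them, while they
  sum to 1. This subadditivity is what separates \<open>D\<^sup>\<alpha>\<close> from
  \<open>b\<^sup>\<alpha>\<close> in the gradient estimate.\<close>

lemma rpow_add_le:
  assumes "0 \<le> p" "p \<le> 1" "0 \<le> a" "0 \<le> b"
  shows "rpow (a + b) p \<le> rpow a p + rpow b p"
proof (cases "p = 0 \<or> a = 0 \<or> b = 0")
  case True
  then show ?thesis by (auto simp: rpow_def)
next
  case False
  then have pos: "0 < a" "0 < b" using assms by auto
  have "c / (a + b) \<le> (c / (a + b)) powr p" if "0 < c" "c \<le> a + b" for c
    using powr_mono'[of p 1 "c / (a + b)"] assms that by (simp add: divide_simps)
  from this[of a] this[of b] have "a / (a + b) + b / (a + b) \<le> (a powr p + b powr p) / (a + b) powr p"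
    using pos by (auto simp: powr_divide add_divide_distrib)
  moreover have "a / (a + b) + b / (a + b) = 1"
    using pos by (simp add: divide_simps)
  ultimately show ?thesis
    using False pos by (simp add: le_divide_eq)
qed

lemma continuous_on_rpow:
  assumes "continuous_on S f" "0 \<le> p" "\<And>x. x \<in> S \<Longrightarrow> 0 \<le> f x"
  shows "continuous_on S (\<lambda>x. rpow (f x) p)"
proof (cases "p = 0")
  case False
  with assms show ?thesis
    by (simp add: rpow_def continuous_on_powr')
qed (simp add: rpow_def)

text \<open>The value at time \<open>1\<close> of the solution of \<open>y' = c y\<^sup>\<alpha>\<close>, \<open>y(0) = 1\<close>.\<close>

definition growth :: "real \<Rightarrow> real \<Rightarrow> real" where
  "growth \<alpha> c = (if \<alpha> = 1 then exp c else (1 + (1 - \<alpha>) * c) powr (1 / (1 - \<alpha>)))"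

lemma growth_mono: "\<lbrakk>\<alpha> \<le> 1; 0 \<le> c; c \<le> d\<rbrakk> \<Longrightarrow> growth \<alpha> c \<le> growth \<alpha> d"
  by (auto simp: growth_def intro!: powr_mono2 mult_left_mono add_nonneg_nonneg)

lemma growth_ge_1: "\<lbrakk>\<alpha> \<le> 1; 0 \<le> c\<rbrakk> \<Longrightarrow> 1 \<le> growth \<alpha> c"
  using growth_mono[of \<alpha> 0 c] by (simp add: growth_def split: if_splits)

text \<open>Needed to turn the implicit condition on the radius into an explicit one. For \<alpha> <
  1 it is the Bernoulli bound \<open>(1 + u)\<^sup>\<alpha> \<le> 1 + \<alpha> u\<close>, taken from
  Young's inequality and multiplied by \<open>(1 + u) powr (-\<alpha>)\<close>; for \<alpha> = 1 it
  is \<open>ln z \<le> z - 1\<close> at \<open>z = 1 / (1 + u)\<close>.\<close>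

lemma growth_le:
  assumes "0 \<le> \<alpha>" "\<alpha> \<le> 1" "0 \<le> u"
  shows "growth \<alpha> (u * (1 + u) powr (-\<alpha>)) \<le> 1 + u"
proof (cases "\<alpha> = 1")
  case True
  have "1 - inverse (1 + u) \<le> ln (1 + u)"
    using ln_le_minus_one[of "inverse (1 + u)"] assms by (simp add: ln_inverse)
  moreover have "u * (1 + u) powr (-1) = 1 - inverse (1 + u)"
    using assms by (simp add: powr_minus field_simps)
  ultimately show ?thesis
    using True assms by (simp add: growth_def ln_ge_iff)
next
  case False
  have "(1 + u) powr \<alpha> \<le> \<alpha> * (1 + u) + (1 - \<alpha>)"
    using Youngs_inequality_0[of \<alpha> "1 - \<alpha>" "1 + u" 1] assms by simp
  then have "(1 + u) powr \<alpha> + (1 - \<alpha>) * u \<le> 1 + u"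
    by (simp add: algebra_simps)
  then have "((1 + u) powr \<alpha> + (1 - \<alpha>) * u) * (1 + u) powr (-\<alpha>) \<le> (1 + u) * (1 + u) powr (-\<alpha>)"
    by (rule mult_right_mono) simp
  moreover have "(1 + u) powr \<alpha> * (1 + u) powr (-\<alpha>) = 1"
    using assms by (simp flip: powr_add)
  moreover have "(1 + u) * (1 + u) powr (-\<alpha>) = (1 + u) powr (1 - \<alpha>)"
    using assms powr_add[of "1 + u" 1 "-\<alpha>"] by simp
  ultimately have "1 + (1 - \<alpha>) * (u * (1 + u) powr (-\<alpha>)) \<le> (1 + u) powr (1 - \<alpha>)"
    by (simp add: algebra_simps)
  then have "growth \<alpha> (u * (1 + u) powr (-\<alpha>)) \<le> ((1 + u) powr (1 - \<alpha>)) powr (1 / (1 - \<alpha>))"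
    using False assms by (auto simp: growth_def intro!: powr_mono2 add_nonneg_nonneg)
  also have "\<dots> = 1 + u"
    using False assms by (simp add: powr_powr)
  finally show ?thesis .
qed

text \<open>Separation of variables: \<open>ln (Y t) - c * t\<close> for \<alpha> = 1, and
  \<open>Y t powr (1 - \<alpha>) - (1 - \<alpha>) * c * t\<close> otherwise, are nonincreasing;
  solving for \<open>Y 1\<close> gives \<open>growth\<close>. The bound \<open>1 \<le> Y t\<close>
  keeps the logarithm and the powers differentiable.\<close>

lemma Bihari_growth:
  fixes Y Y' :: "real \<Rightarrow> real"
  assumes \<alpha>: "0 \<le> \<alpha>" "\<alpha> \<le> 1"
    and cont: "continuous_on {0..1} Y"
    and deriv: "\<And>t. \<lbrakk>0 < t; t < 1\<rbrakk> \<Longrightarrow> (Y has_real_derivative Y' t) (at t)"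
    and bound: "\<And>t. \<lbrakk>0 < t; t < 1\<rbrakk> \<Longrightarrow> Y' t \<le> c * Y t powr \<alpha>"
    and init: "Y 0 = 1" and ge1: "\<And>t. \<lbrakk>0 \<le> t; t \<le> 1\<rbrakk> \<Longrightarrow> 1 \<le> Y t"
  shows "Y 1 \<le> growth \<alpha> c"
proof -
  have Y_ne: "Y t \<noteq> 0" if "t \<in> {0..1}" for t
    using ge1[of t] that by auto
  show ?thesis
  proof (cases "\<alpha> = 1")
    case True
    have "ln (Y 1) - c * 1 \<le> ln (Y 0) - c * 0"
    proof (rule DERIV_nonpos_imp_decreasing_open[where f = "\<lambda>t. ln (Y t) - c * t"])
      fix t :: real assume t: "0 < t" "t < 1"
      have "1 \<le> Y t" using ge1 t by simp
      then have "((\<lambda>t. ln (Y t) - c * t) has_real_derivative (Y' t / Y t - c)) (at t)"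
        by (auto intro!: derivative_eq_intros deriv t)
      moreover have "Y' t / Y t - c \<le> 0"
        using bound[OF t] \<open>1 \<le> Y t\<close> True by (simp add: divide_simps)
      ultimately show "\<exists>y. ((\<lambda>t. ln (Y t) - c * t) has_real_derivative y) (at t) \<and> y \<le> 0"
        by blast
    next
      show "continuous_on {0..1} (\<lambda>t. ln (Y t) - c * t)"
        using Y_ne by (intro continuous_intros cont) auto
    qed simp
    moreover have "0 < Y 1" using ge1[of 1] by simp
    ultimately have "Y 1 \<le> exp c"
      using init by (simp flip: ln_le_cancel_iff)
    then show ?thesis using True by (simp add: growth_def)
  next
    case False
    have "Y 1 powr (1 - \<alpha>) - (1 - \<alpha>) * c * 1 \<le> Y 0 powr (1 - \<alpha>) - (1 - \<alpha>) * c * 0"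
    proof (rule DERIV_nonpos_imp_decreasing_open[where f = "\<lambda>t. Y t powr (1 - \<alpha>) - (1 - \<alpha>) * c * t"])
      fix t :: real assume t: "0 < t" "t < 1"
      have Y: "1 \<le> Y t" using ge1 t by simp
      then have "((\<lambda>t. Y t powr (1 - \<alpha>) - (1 - \<alpha>) * c * t) has_real_derivative
          ((1 - \<alpha>) * (Y t powr (-\<alpha>) * Y' t) - (1 - \<alpha>) * c)) (at t)"
        by (auto intro!: derivative_eq_intros deriv t)
      moreover have "(1 - \<alpha>) * (Y t powr (-\<alpha>) * Y' t) - (1 - \<alpha>) * c \<le> 0"
      proof -
        have "Y t powr (-\<alpha>) * Y' t \<le> Y t powr (-\<alpha>) * (c * Y t powr \<alpha>)"
          by (rule mult_left_mono[OF bound[OF t]]) simp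
        also have "\<dots> = c * Y t powr (-\<alpha> + \<alpha>)"
          by (simp only: powr_add) simp
        also have "\<dots> = c" using Y by simp
        finally show ?thesis using \<alpha> by (simp add: mult_left_mono)
      qed
      ultimately show "\<exists>y. ((\<lambda>t. Y t powr (1 - \<alpha>) - (1 - \<alpha>) * c * t) has_real_derivative y) (at t) \<and> y \<le> 0"
        by blast
    next
      show "continuous_on {0..1} (\<lambda>t. Y t powr (1 - \<alpha>) - (1 - \<alpha>) * c * t)"
        using Y_ne by (intro continuous_intros cont) auto
    qed simp
    then have "Y 1 powr (1 - \<alpha>) \<le> 1 + (1 - \<alpha>) * c"
      using init by simp
    then have "(Y 1 powr (1 - \<alpha>)) powr (1 / (1 - \<alpha>)) \<le> growth \<alpha> c"
      using False \<alpha> by (auto simp: growth_def intro!: powr_mono2)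
    then show ?thesis
      using False \<alpha> ge1[of 1] by (simp add: powr_powr)
  qed
qed

subsection \<open>Gradients along segments\<close>

text \<open>The smoothness condition between \<open>x\<close> and \<open>x + t s\<close> averages
  over a rescaled segment. The substitution \<open>u * t\<close> turns this into a running integral
  over \<open>{0..t}\<close>, which can be differentiated in \<open>t\<close>.\<close>

lemma integral_scaled:
  fixes p :: "real \<Rightarrow> real"
  assumes "continuous_on UNIV p" "0 \<le> t"
  shows "t * integral {0..1} (\<lambda>u. p (u * t)) = integral {0..t} p"
proof -
  have "((\<lambda>u. t *\<^sub>R p (u * t)) has_integral integral {0 * t..1 * t} p) {0..1}"
  proof (rule has_integral_substitution[where c = 0 and d = t])
    show "continuous_on {0..t} p"
      using assms(1) continuous_on_subset by blast
    show "((\<lambda>u. u * t) has_real_derivative t) (at u within {0..1})" for u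
      by (auto intro!: derivative_eq_intros)
    show "(\<lambda>u. u * t) ` {0..1} \<subseteq> {0..t}"
      using assms(2) by (auto intro: mult_left_le_one_le)
  qed (use assms(2) in simp_all)
  from integral_unique[OF this] show ?thesis by simp
qed

text \<open>Since \<open>grad\<close> is a definite description, a gradient must be shown to exist
  and be unique. The Riesz vector of the derivative, with coordinates \<open>f' b\<close>, is one;
  uniqueness of the derivative excludes any other.\<close>

lemma GDERIV_grad:
  assumes "C1 f"
  shows "GDERIV f x :> grad f x"
proof -
  obtain f' where f': "(f has_derivative f') (at x)"
    using assms unfolding C1_def differentiable_def by blast
  interpret f': linear f' by (rule has_derivative_linear[OF f'])
  have f'_eq: "f' = (\<lambda>h. h \<bullet> (\<Sum>b\<in>Basis. f' b *\<^sub>R b))"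
  proof
    fix h
    have "f' h = f' (\<Sum>b\<in>Basis. (h \<bullet> b) *\<^sub>R b)" by (simp add: euclidean_representation)
    also have "\<dots> = h \<bullet> (\<Sum>b\<in>Basis. f' b *\<^sub>R b)"
      by (simp only: f'.sum f'.scale) (simp add: inner_sum_right mult.commute)
    finally show "f' h = h \<bullet> (\<Sum>b\<in>Basis. f' b *\<^sub>R b)" .
  qed
  have D: "GDERIV f x :> (\<Sum>b\<in>Basis. f' b *\<^sub>R b)" (is "GDERIV f x :> ?D")
    unfolding gderiv_def by (rule has_derivative_eq_rhs[OF f' f'_eq])
  show ?thesis
    unfolding grad_def
  proof (rule theI[where a = ?D])
    fix E assume "GDERIV f x :> E"
    then have "(\<lambda>h. h \<bullet> E) = (\<lambda>h. h \<bullet> ?D)"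
      using D unfolding gderiv_def by (rule has_derivative_unique)
    then show "E = ?D" by (simp add: fun_eq_iff vector_eq_ldot)
  qed (rule D)
qed

lemma has_derivative_along_segment:
  assumes "C1 f"
  shows "((\<lambda>t. f (x + t *\<^sub>R s)) has_real_derivative (grad f (x + t *\<^sub>R s) \<bullet> s)) (at t)"
proof -
  have inner: "((\<lambda>t. x + t *\<^sub>R s) has_derivative (\<lambda>r. r *\<^sub>R s)) (at t)"
    by (auto intro!: derivative_eq_intros)
  have outer: "(f has_derivative (\<lambda>h. h \<bullet> grad f (x + t *\<^sub>R s))) (at (x + t *\<^sub>R s))"
    using GDERIV_grad[OF assms] by (simp add: gderiv_def)
  show ?thesis
    unfolding has_field_derivative_def
    by (rule has_derivative_eq_rhs[OF has_derivative_compose[OF inner outer]])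
      (auto simp: inner_commute)
qed

subsection \<open>The auxiliary functions\<close>

locale smoothness_constants =
  fixes \<alpha> L0 L1 :: real
  assumes \<alpha>: "0 \<le> \<alpha>" "\<alpha> \<le> 1" and L: "0 \<le> L0" "0 \<le> L1" "L0 > 0 \<or> L1 > 0"
begin

text \<open>The local Lipschitz constant suggested by a gradient of norm \<open>b\<close>. It is the
  denominator of \<psi> and, as \<open>b0 \<le> L0\<close> and \<open>b1 \<le> L1\<close>, also
  bounds the model Hessians.\<close>

definition W :: "real \<Rightarrow> real" where
  "W b = L0 + L1 * rpow b \<alpha>"

lemma W_pos: "0 < b \<Longrightarrow> 0 < W b"
  using L by (auto simp: W_def add_pos_nonneg add_nonneg_pos)

lemma W_mono: "\<lbrakk>0 \<le> a; a \<le> b\<rbrakk> \<Longrightarrow> W a \<le> W b"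
  using \<alpha> L by (auto simp: W_def intro!: rpow_mono mult_left_mono)

lemma aux_psi_eq: "aux_psi \<alpha> L0 L1 b = b / W b"
  by (simp add: aux_psi_def W_def)

text \<open>After cross-multiplication the \<open>L1\<close> part reads
  \<open>a * b powr \<alpha> \<le> b * a powr \<alpha>\<close>, which is
  \<open>a powr (1 - \<alpha>) \<le> b powr (1 - \<alpha>)\<close> multiplied by
  \<open>a powr \<alpha> * b powr \<alpha>\<close>.\<close>

lemma aux_psi_mono:
  assumes "0 < a" "a \<le> b"
  shows "a / W a \<le> b / W b"
proof -
  have "a powr (1 - \<alpha>) \<le> b powr (1 - \<alpha>)"
    using assms \<alpha> by (simp add: powr_mono2)
  then have "(a powr \<alpha> * b powr \<alpha>) * a powr (1 - \<alpha>) \<le> (a powr \<alpha> * b powr \<alpha>) * b powr (1 - \<alpha>)"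
    by (rule mult_left_mono) simp
  moreover have split: "c powr \<alpha> * c powr (1 - \<alpha>) = c" if "0 < c" for c :: real
    using that by (simp flip: powr_add)
  have "(a powr \<alpha> * b powr \<alpha>) * a powr (1 - \<alpha>) = a * b powr \<alpha>"
    using split[OF assms(1)] by (metis mult.assoc mult.commute)
  moreover have "(a powr \<alpha> * b powr \<alpha>) * b powr (1 - \<alpha>) = b * a powr \<alpha>"
    using split[of b] assms by (metis mult.assoc mult.commute less_le_trans)
  ultimately have "L1 * (a * b powr \<alpha>) \<le> L1 * (b * a powr \<alpha>)"
    using L by (simp add: mult_left_mono)
  moreover have "a * L0 \<le> b * L0" using assms L by (simp add: mult_right_mono)
  ultimately have "a * W b \<le> b * W a"
    using assms by (simp add: W_def algebra_simps)
  then show ?thesis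
    using assms W_pos[of a] W_pos[of b] by (simp add: divide_simps mult.commute)
qed

text \<open>The function \<open>aux_g\<close> written through \<open>growth\<close>, so that one
  formula serves all \<alpha>: for \<alpha> = 1 the divisor is \<open>W b powr 0\<close>, which is 1
  when \<open>b > 0\<close>.\<close>

definition G :: "real \<Rightarrow> real \<Rightarrow> real" where
  "G a b = growth \<alpha> (L1 * rpow a \<alpha> / W b powr (1 - \<alpha>))"

lemma aux_g_eq:
  assumes "0 \<le> a" "0 < b"
  shows "aux_g \<alpha> L0 L1 a b = G a b"
proof (cases "\<alpha> = 1")
  case True
  have "W b \<noteq> 0" using W_pos[OF assms(2)] by simp
  then show ?thesis unfolding aux_g_def growth_def G_def using True assms by (simp add: rpow_def)
next
  case False
  then show ?thesis
    unfolding aux_g_def growth_def G_def W_def[symmetric] by (simp add: mult.assoc)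
qed

lemma G_ge_1: "0 < b \<Longrightarrow> 1 \<le> G a b"
  unfolding G_def using \<alpha> L by (intro growth_ge_1) auto

lemma G_mono: "\<lbrakk>0 \<le> a; a \<le> a'; 0 < b\<rbrakk> \<Longrightarrow> G a b \<le> G a' b"
  unfolding G_def using \<alpha> L
  by (intro growth_mono divide_right_mono mult_left_mono rpow_mono) auto

lemma G_antimono:
  assumes "0 < b" "b \<le> b'"
  shows "G a b' \<le> G a b"
  unfolding G_def
proof (intro growth_mono divide_left_mono)
  show "W b powr (1 - \<alpha>) \<le> W b' powr (1 - \<alpha>)"
    using \<alpha> assms W_pos[of b] W_mono[of b b'] by (intro powr_mono2) auto
  show "0 < W b' powr (1 - \<alpha>) * W b powr (1 - \<alpha>)"
    using assms W_pos[of b] W_pos[of b'] by simp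
qed (use \<alpha> L in auto)

lemma mult_G_strict_mono:
  assumes "0 \<le> a" "a < a'" "0 < b"
  shows "a * G a b < a' * G a' b"
proof -
  have "a * G a b \<le> a * G a' b"
    using assms by (intro mult_left_mono G_mono) auto
  also have "\<dots> < a' * G a' b"
    using assms G_ge_1[of b a'] by (intro mult_strict_right_mono) auto
  finally show ?thesis .
qed

lemma continuous_on_mult_G:
  assumes "0 < b"
  shows "continuous_on {0..t} (\<lambda>a. a * G a b)"
proof -
  have c: "continuous_on {0..t} (\<lambda>a. L1 * rpow a \<alpha> / W b powr (1 - \<alpha>))"
    using \<alpha> W_pos[OF assms] by (intro continuous_intros continuous_on_rpow) auto
  have "continuous_on {0..t} (\<lambda>a. G a b)"
  proof (cases "\<alpha> = 1")
    case True
    then show ?thesis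
      unfolding G_def growth_def using c by (auto intro: continuous_on_exp)
  next
    case False
    have "1 + (1 - \<alpha>) * (L1 * rpow a \<alpha> / W b powr (1 - \<alpha>)) \<noteq> 0" for a
      using \<alpha> L
      by (intro less_imp_neq[symmetric] add_pos_nonneg mult_nonneg_nonneg divide_nonneg_nonneg) auto
    then show ?thesis
      unfolding G_def growth_def using False
      by (simp only: if_False) (intro continuous_on_powr continuous_intros c; blast)
  qed
  then show ?thesis by (intro continuous_intros)
qed

text \<open>The description defining \<open>aux_h\<close> is justified by the intermediate value
  theorem on \<open>{0..t}\<close>, where \<open>G \<ge> 1\<close> pushes the right end value to at
  least \<open>t\<close>, and by strict monotonicity for uniqueness.\<close>

lemma aux_h:
  assumes "0 < b" "0 < t"
  shows "0 < aux_h \<alpha> L0 L1 b t" "aux_h \<alpha> L0 L1 b t * G (aux_h \<alpha> L0 L1 b t) b = t"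
proof -
  have "t * 1 \<le> t * G t b"
    using assms G_ge_1[of b t] by (intro mult_left_mono) auto
  then obtain a where a: "0 \<le> a" "a \<le> t" "a * G a b = t"
    using IVT'[of "\<lambda>a. a * G a b" 0 t t] continuous_on_mult_G[of b t] assms by auto
  have "\<exists>!a. 0 < a \<and> a * aux_g \<alpha> L0 L1 a b = t"
  proof (rule ex1I[of _ a])
    show "0 < a \<and> a * aux_g \<alpha> L0 L1 a b = t"
      using a assms by (cases "a = 0") (auto simp: aux_g_eq)
  next
    fix a' assume "0 < a' \<and> a' * aux_g \<alpha> L0 L1 a' b = t"
    then have "0 \<le> a'" "a' * G a' b = t" using assms by (auto simp: aux_g_eq)
    with a assms show "a' = a"
      using mult_G_strict_mono[of a a' b] mult_G_strict_mono[of a' a b] by linarith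
  qed
  from theI'[OF this]
  have "0 < aux_h \<alpha> L0 L1 b t \<and> aux_h \<alpha> L0 L1 b t * aux_g \<alpha> L0 L1 (aux_h \<alpha> L0 L1 b t) b = t"
    by (simp add: aux_h_def)
  then show "0 < aux_h \<alpha> L0 L1 b t" "aux_h \<alpha> L0 L1 b t * G (aux_h \<alpha> L0 L1 b t) b = t"
    using assms by (auto simp: aux_g_eq)
qed

lemma le_aux_h:
  assumes "0 < b" "0 < a" "a * G a b \<le> t"
  shows "a \<le> aux_h \<alpha> L0 L1 b t"
proof -
  have "0 < a * G a b" using assms G_ge_1[of b a] by simp
  then have "0 < t" using assms by simp
  from aux_h[OF assms(1) this] assms show ?thesis
    using mult_G_strict_mono[of "aux_h \<alpha> L0 L1 b t" a b] by linarith
qed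

text \<open>The denominator equals
  \<open>W \<epsilon> + L1 * rpow (c * \<epsilon>) \<alpha>\<close>. The second summand compensates
  for the factor \<open>G\<close>, and the split of the denominator into an \<open>L0\<close> and an
  \<open>L1\<close> term becomes the two terms of the final bound.\<close>

definition safe_radius :: "real \<Rightarrow> real \<Rightarrow> real" where
  "safe_radius c \<epsilon> = c * \<epsilon> / (L0 + L1 * (1 + rpow c \<alpha>) * rpow \<epsilon> \<alpha>)"

lemma safe_radius_pos:
  assumes "0 < c" "0 < \<epsilon>"
  shows "0 < safe_radius c \<epsilon>"
proof -
  have "0 < W \<epsilon> + L1 * rpow (c * \<epsilon>) \<alpha>"
    using W_pos[of \<epsilon>] L assms by (intro add_pos_nonneg) auto
  then have "0 < L0 + L1 * (1 + rpow c \<alpha>) * rpow \<epsilon> \<alpha>"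
    by (simp only: W_def rpow_mult) (simp add: algebra_simps)
  then show ?thesis
    using assms by (simp add: safe_radius_def)
qed

text \<open>With \<open>u\<close> the ratio of the two summands of the denominator, the argument of
  \<open>growth\<close> at this radius is exactly \<open>u * (1 + u) powr (-\<alpha>)\<close>, so
  \<open>G \<le> 1 + u\<close>, and the factor \<open>1 + u\<close> cancels. This settles
  \<open>b = \<epsilon>\<close>; larger \<open>b\<close> decrease \<open>G\<close> and increase
  \<psi>.\<close>

lemma safe_radius_le:
  assumes "0 < c" "0 < \<epsilon>" "\<epsilon> \<le> b"
  shows "safe_radius c \<epsilon> * G (safe_radius c \<epsilon>) b \<le> c * (b / W b)"
proof -
  define w where "w = W \<epsilon>"
  define u where "u = L1 * (c * \<epsilon>) powr \<alpha> / w"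
  have w: "0 < w" using W_pos assms by (simp add: w_def)
  have u: "0 \<le> u" using w L by (simp add: u_def)
  have "L0 + L1 * (1 + rpow c \<alpha>) * rpow \<epsilon> \<alpha> = W \<epsilon> + L1 * rpow (c * \<epsilon>) \<alpha>"
    unfolding W_def rpow_mult by (simp add: algebra_simps)
  also have "\<dots> = w * (1 + u)"
    using w assms by (simp add: u_def w_def[symmetric] distrib_left)
  finally have r: "safe_radius c \<epsilon> = c * \<epsilon> / (w * (1 + u))"
    by (simp add: safe_radius_def)
  have "L1 * rpow (safe_radius c \<epsilon>) \<alpha> / w powr (1 - \<alpha>)
      = L1 * (c * \<epsilon>) powr \<alpha> / (w powr \<alpha> * w powr (1 - \<alpha>)) / (1 + u) powr \<alpha>"
    using w u assms by (simp add: r powr_divide powr_mult)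
  also have "\<dots> = L1 * (c * \<epsilon>) powr \<alpha> / w / (1 + u) powr \<alpha>"
    using w by (simp flip: powr_add)
  also have "\<dots> = u * (1 + u) powr (-\<alpha>)"
    unfolding u_def[symmetric] by (simp add: powr_minus divide_inverse)
  finally have "L1 * rpow (safe_radius c \<epsilon>) \<alpha> / w powr (1 - \<alpha>) = u * (1 + u) powr (-\<alpha>)" .
  then have G_le: "G (safe_radius c \<epsilon>) \<epsilon> \<le> 1 + u"
    using growth_le[OF \<alpha> u] by (simp add: G_def w_def)
  have "safe_radius c \<epsilon> * G (safe_radius c \<epsilon>) b \<le> safe_radius c \<epsilon> * (1 + u)"
    using G_le G_antimono[OF assms(2,3)] safe_radius_pos[OF assms(1,2)]
    by (intro mult_left_mono) (auto intro: order_trans)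
  also have "\<dots> = c * (\<epsilon> / W \<epsilon>)"
    using u w by (simp add: r w_def)
  also have "\<dots> \<le> c * (b / W b)"
    using assms aux_psi_mono[of \<epsilon> b] by (intro mult_left_mono) auto
  finally show ?thesis .
qed

subsection \<open>Very successful iterations\<close>

text \<open>Subadditivity bounds the integrand by
  \<open>rpow b \<alpha> + rpow (D t) \<alpha>\<close>, which closes the integral inequality in
  \<open>D\<close>. Scaling by \<open>a * w\<close> normalises it to \<open>Y 0 = 1\<close>, and the
  comparison at time 1 produces the factor \<open>G a b\<close>.\<close>

lemma grad_diff_le:
  fixes f :: "real ^ 'n \<Rightarrow> real"
  assumes C1: "C1 f" and smooth: "alpha_smooth \<alpha> L0 L1 f" and pos: "0 < norm (grad f x)"
  shows "norm (grad f (x + s) - grad f x)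
    \<le> W (norm (grad f x)) * norm s * G (norm s) (norm (grad f x))"
proof -
  define a b w where "a = norm s" and "b = norm (grad f x)" and "w = W (norm (grad f x))"
  define p where "p t = rpow (norm (grad f (x + t *\<^sub>R s))) \<alpha>" for t
  define D where "D t = norm (grad f (x + t *\<^sub>R s) - grad f x)" for t
  define q where "q t = rpow (D t) \<alpha>" for t
  \<comment> \<open>Smoothness gives \<open>D \<le> a w Y\<close>, so \<open>Y' = (L1 / w) D\<^sup>\<alpha>\<close> is at most a multiple of \<open>Y\<^sup>\<alpha>\<close>.\<close>
  define Y where "Y t = 1 + L1 / w * integral {0..t} q" for t
  have w: "0 < w" using W_pos[OF pos] by (simp add: w_def)
  have "continuous_on UNIV (grad f)" using C1 by (simp add: C1_def)
  then have gc: "continuous_on UNIV (\<lambda>t. grad f (x + t *\<^sub>R s))"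
    by (rule continuous_on_compose2) (auto intro!: continuous_intros)
  have pc: "continuous_on UNIV p" and qc: "continuous_on UNIV q"
    unfolding p_def q_def D_def using \<alpha>
    by (intro continuous_on_rpow continuous_intros gc; simp)+
  have pi: "p integrable_on {0..t}" and qi: "q integrable_on {0..t}" for t
    using pc qc by (auto intro!: integrable_continuous_real intro: continuous_on_subset)
  have q_nonneg: "0 \<le> q t" for t by (simp add: q_def)
  have D_le: "D t \<le> a * w * Y t" if t: "0 \<le> t" "t \<le> 1" for t
  proof -
    have "integral {0..t} p \<le> integral {0..t} (\<lambda>u. rpow b \<alpha> + q u)"
    proof (rule integral_le[OF pi])
      show "(\<lambda>u. rpow b \<alpha> + q u) integrable_on {0..t}"
        by (intro integrable_add qi) auto
      fix u
      have "norm (grad f (x + u *\<^sub>R s)) \<le> b + D u"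
        using norm_triangle_sub[of "grad f (x + u *\<^sub>R s)" "grad f x"] by (simp add: b_def D_def)
      then have "p u \<le> rpow (b + D u) \<alpha>"
        using \<alpha> by (simp add: p_def rpow_mono)
      also have "\<dots> \<le> rpow b \<alpha> + q u"
        unfolding q_def using \<alpha> by (intro rpow_add_le) (auto simp: b_def D_def)
      finally show "p u \<le> rpow b \<alpha> + q u" .
    qed
    also have "\<dots> = t * rpow b \<alpha> + integral {0..t} q"
      using t by (subst integral_add) (auto intro: qi)
    finally have I_le: "integral {0..t} p \<le> t * rpow b \<alpha> + integral {0..t} q" .
    have "D t \<le> (L0 + L1 * integral {0..1} (\<lambda>u. p (u * t))) * (t * a)"
      using smooth[unfolded alpha_smooth_def, rule_format, of x "x + t *\<^sub>R s"] t
      by (simp add: D_def a_def p_def norm_minus_commute)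
    also have "\<dots> = a * (L0 * t + L1 * (t * integral {0..1} (\<lambda>u. p (u * t))))"
      by (simp add: algebra_simps)
    also have "\<dots> = a * (L0 * t + L1 * integral {0..t} p)"
      using integral_scaled[OF pc t(1)] by simp
    also have "\<dots> \<le> a * (L0 * t + L1 * (t * rpow b \<alpha> + integral {0..t} q))"
      using L I_le by (intro mult_left_mono add_left_mono) (auto simp: a_def)
    also have "\<dots>
        = a * (w * t + L1 * integral {0..t} q)"
      by (simp add: w_def W_def b_def algebra_simps)
    also have "\<dots> = a * w * (t + L1 / w * integral {0..t} q)"
      using w by (simp add: algebra_simps)
    \<comment> \<open>The summand \<open>t\<close> is enlarged to 1, so that \<open>Y\<close> starts
      at 1 and stays above it.\<close>
    also have "\<dots> \<le> a * w * Y t"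
      using w t by (intro mult_left_mono) (auto simp: Y_def a_def)
    finally show ?thesis .
  qed
  have Y_ge: "1 \<le> Y t" for t
    using w L q_nonneg by (simp add: Y_def integral_nonneg qi)
  have deriv: "(Y has_real_derivative L1 / w * q t) (at t within {0..1})" if "t \<in> {0..1}" for t
  proof -
    have "((\<lambda>t. integral {0..t} q) has_real_derivative q t) (at t within {0..1})"
      using that continuous_on_subset[OF qc] by (intro integral_has_real_derivative) auto
    from DERIV_add[OF DERIV_const[of 1] DERIV_cmult[OF this, of "L1 / w"]] show ?thesis
      unfolding Y_def by simp
  qed
  have "Y 1 \<le> growth \<alpha> (L1 * rpow a \<alpha> / w powr (1 - \<alpha>))"
  proof (rule Bihari_growth[OF \<alpha>])
    show "continuous_on {0..1} Y"
      using deriv by (meson DERIV_continuous_on)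
    show "(Y has_real_derivative L1 / w * q t) (at t)" if "0 < t" "t < 1" for t
    proof -
      have "at t within {0..1} = at t" using that by (intro at_within_interior) auto
      with deriv[of t] that show ?thesis by simp
    qed
    show "L1 / w * q t \<le> L1 * rpow a \<alpha> / w powr (1 - \<alpha>) * Y t powr \<alpha>" if "0 < t" "t < 1" for t
    proof -
      have "q t \<le> rpow (a * w * Y t) \<alpha>"
        unfolding q_def using D_le[of t] that \<alpha> by (intro rpow_mono) (auto simp: D_def)
      also have "\<dots> = rpow a \<alpha> * w powr \<alpha> * Y t powr \<alpha>"
        using w Y_ge[of t] by (simp add: rpow_mult)
      finally have "L1 / w * q t \<le> L1 / w * (rpow a \<alpha> * w powr \<alpha> * Y t powr \<alpha>)"
        using w L by (intro mult_left_mono) auto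
      also have "\<dots> = L1 * rpow a \<alpha> * (w powr \<alpha> / w) * Y t powr \<alpha>"
        by simp
      also have "\<dots> = L1 * rpow a \<alpha> / w powr (1 - \<alpha>) * Y t powr \<alpha>"
        using w by (simp add: powr_diff)
      finally show ?thesis .
    qed
  qed (use L Y_ge in \<open>auto simp: Y_def\<close>)
  then have "a * w * Y 1 \<le> a * w * G a b"
    using w by (intro mult_left_mono) (auto simp: G_def w_def b_def a_def)
  with D_le[of 1] have "D 1 \<le> a * w * G a b" by simp
  then show ?thesis
    by (simp add: D_def a_def w_def b_def mult_ac)
qed

text \<open>The gradient estimate is integrated along the segment, with \<open>G\<close> frozen at
  its value for the full length of \<open>s\<close>. The derivative of the remainder is then at most
  \<open>t * K\<close>, whence the factor 1/2.\<close>

lemma quadratic_upper_bound: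
  fixes f :: "real ^ 'n \<Rightarrow> real"
  assumes C1: "C1 f" and smooth: "alpha_smooth \<alpha> L0 L1 f" and pos: "0 < norm (grad f x)"
  shows "f (x + s) \<le> f x + grad f x \<bullet> s
    + 1/2 * (W (norm (grad f x)) * (norm s)\<^sup>2 * G (norm s) (norm (grad f x)))"
proof -
  define a b K where "a = norm s" and "b = norm (grad f x)" and "K = W b * a\<^sup>2 * G a b"
  define \<phi> where "\<phi> t = f (x + t *\<^sub>R s) - t * (grad f x \<bullet> s) - t\<^sup>2 / 2 * K" for t
  have "\<phi> 1 \<le> \<phi> 0"
  proof (rule DERIV_nonpos_imp_nonincreasing[of 0 1 \<phi>])
    fix t :: real assume t: "0 \<le> t" "t \<le> 1"
    have "(\<phi> has_real_derivative grad f (x + t *\<^sub>R s) \<bullet> s - grad f x \<bullet> s - t * K) (at t)"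
      unfolding \<phi>_def
      by (rule derivative_eq_intros has_derivative_along_segment[OF C1] refl | simp)+
    moreover have "grad f (x + t *\<^sub>R s) \<bullet> s - grad f x \<bullet> s - t * K \<le> 0"
    proof -
      have "grad f (x + t *\<^sub>R s) \<bullet> s - grad f x \<bullet> s = (grad f (x + t *\<^sub>R s) - grad f x) \<bullet> s"
        by (simp add: inner_diff_left)
      also have "\<dots> \<le> norm (grad f (x + t *\<^sub>R s) - grad f x) * a"
        unfolding a_def by (rule norm_cauchy_schwarz)
      also have "\<dots> \<le> (W b * (t * a) * G (t * a) b) * a"
        using grad_diff_le[OF C1 smooth pos, of "t *\<^sub>R s"] t
        by (intro mult_right_mono) (auto simp: a_def b_def)
      also have "\<dots> \<le> (W b * (t * a) * G a b) * a"
        using t W_pos[of b] pos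
        by (intro mult_right_mono mult_left_mono G_mono) (auto simp: a_def b_def mult_left_le_one_le)
      also have "\<dots> = t * K"
        by (simp add: K_def power2_eq_square)
      finally show ?thesis by simp
    qed
    ultimately show "\<exists>y. (\<phi> has_real_derivative y) (at t) \<and> y \<le> 0" by blast
  qed simp
  then show ?thesis by (simp add: \<phi>_def K_def a_def b_def)
qed

lemma model_decrease_ge:
  assumes "admissible_step f \<kappa> x B \<Delta> s" "matrix_norm B \<le> W (norm (grad f x))"
    "0 < \<kappa>" "0 < norm (grad f x)"
  shows "\<kappa> * norm (grad f x) * min (norm (grad f x) / W (norm (grad f x))) \<Delta> \<le> model_decrease f x B s"
proof -
  define b where "b = norm (grad f x)"
  have "min (b / W b) \<Delta> \<le> (if B = 0 then \<Delta> else min (b / matrix_norm B) \<Delta>)"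
  proof (cases "B = 0")
    case False
    then have "0 < matrix_norm B"
      unfolding matrix_norm_def
      using onorm_pos_lt[OF matrix_vector_mul_bounded_linear[of B]] matrix_eq[of B 0] by auto
    then have "b / W b \<le> b / matrix_norm B"
      using assms by (intro divide_left_mono) (auto simp: b_def)
    with False show ?thesis by auto
  qed simp
  then have "\<kappa> * b * min (b / W b) \<Delta> \<le> \<kappa> * b * (if B = 0 then \<Delta> else min (b / matrix_norm B) \<Delta>)"
    using assms by (intro mult_left_mono) (auto simp: b_def)
  also have "\<dots> \<le> model_decrease f x B s"
    using assms(1) unfolding admissible_step_def b_def by blast
  finally show ?thesis by (simp add: b_def)
qed

text \<open>The smallness condition forces \<open>\<Delta> \<le> b / W b\<close>, so the model
  decrease \<open>m\<close> is at least \<open>\<kappa> * b * \<Delta>\<close>. The Taylor remainder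
  and the Hessian term each contribute at most half of
  \<open>W b * \<Delta>\<^sup>2 * G \<Delta> b\<close> to the gap between model and actual decrease,
  and that product is at most \<open>(1 - \<eta>) * m\<close>.\<close>

lemma tr_ratio_ge:
  fixes f :: "real ^ 'n \<Rightarrow> real"
  assumes C1: "C1 f" and smooth: "alpha_smooth \<alpha> L0 L1 f"
    and step: "admissible_step f \<kappa> x B \<Delta> s" and B: "matrix_norm B \<le> W (norm (grad f x))"
    and \<kappa>: "0 < \<kappa>" "\<kappa> \<le> 1" and \<eta>: "0 \<le> \<eta>" "\<eta> < 1" and pos: "0 < norm (grad f x)" and \<Delta>: "0 < \<Delta>"
    and small: "\<Delta> * G \<Delta> (norm (grad f x)) \<le> \<kappa> * (1 - \<eta>) * (norm (grad f x) / W (norm (grad f x)))"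
  shows "\<eta> \<le> tr_ratio f x B s"
proof -
  define b where "b = norm (grad f x)"
  define m where "m = model_decrease f x B s"
  have b: "0 < b" and w: "0 < W b" using pos W_pos by (auto simp: b_def)
  have s: "norm s \<le> \<Delta>" using step by (simp add: admissible_step_def)
  have "\<Delta> * 1 \<le> \<Delta> * G \<Delta> b"
    using G_ge_1[OF b] \<Delta> by (intro mult_left_mono) auto
  also have "\<dots> \<le> \<kappa> * (1 - \<eta>) * (b / W b)" using small by (simp add: b_def)
  also have "\<dots> \<le> 1 * (b / W b)"
    using \<kappa> \<eta> b w by (intro mult_right_mono mult_le_one) auto
  finally have "min (b / W b) \<Delta> = \<Delta>" by simp
  with model_decrease_ge[OF step B \<kappa>(1) pos] have m: "\<kappa> * b * \<Delta> \<le> m"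
    by (simp add: b_def m_def)
  have "0 < \<kappa> * b * \<Delta>" using \<kappa> b \<Delta> by simp
  with m have m_pos: "0 < m" by linarith
  have "\<bar>s \<bullet> (B *v s)\<bar> \<le> norm s * norm (B *v s)" by (rule Cauchy_Schwarz_ineq2)
  also have "\<dots> \<le> norm s * (matrix_norm B * norm s)"
    unfolding matrix_norm_def
    by (intro mult_left_mono onorm matrix_vector_mul_bounded_linear) simp
  also have "\<dots> \<le> norm s * (W b * norm s)"
    using B by (intro mult_left_mono mult_right_mono) (auto simp: b_def)
  finally have sBs: "- (s \<bullet> (B *v s)) \<le> W b * (norm s)\<^sup>2 * 1"
    by (simp add: power2_eq_square mult_ac)
  also have "\<dots> \<le> W b * (norm s)\<^sup>2 * G (norm s) b"
    using w G_ge_1[OF b] by (intro mult_left_mono) auto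
  finally have "m - W b * (norm s)\<^sup>2 * G (norm s) b \<le> f x - f (x + s)"
    using quadratic_upper_bound[OF C1 smooth pos, of s]
    by (simp add: m_def model_decrease_def model_def b_def)
  moreover have "W b * (norm s)\<^sup>2 * G (norm s) b \<le> W b * \<Delta>\<^sup>2 * G \<Delta> b"
    using w s \<Delta> G_ge_1[OF b, of "norm s"] G_mono[of "norm s" \<Delta> b] b
    by (intro mult_mono power_mono mult_nonneg_nonneg) auto
  moreover have "W b * \<Delta>\<^sup>2 * G \<Delta> b \<le> (1 - \<eta>) * m"
  proof -
    have "W b * \<Delta>\<^sup>2 * G \<Delta> b = W b * \<Delta> * (\<Delta> * G \<Delta> b)" by (simp add: power2_eq_square)
    also have "\<dots> \<le> W b * \<Delta> * (\<kappa> * (1 - \<eta>) * (b / W b))"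
      using w \<Delta> small by (intro mult_left_mono) (auto simp: b_def)
    also have "\<dots> = (1 - \<eta>) * (\<kappa> * b * \<Delta>)" using w by simp
    also have "\<dots> \<le> (1 - \<eta>) * m" using m \<eta> by (intro mult_left_mono) auto
    finally show ?thesis .
  qed
  ultimately have "\<eta> * m \<le> f x - f (x + s)" by (simp add: algebra_simps)
  with m_pos show ?thesis by (simp add: tr_ratio_def m_def le_divide_eq)
qed

end

subsection \<open>Counting successful iterations\<close>

lemma card_mult_decrease_le:
  fixes v :: "nat \<Rightarrow> real"
  assumes "\<And>k. k < n \<Longrightarrow> v (Suc k) \<le> v k - (if P k then d else 0)"
  shows "real (card {k. k < n \<and> P k}) * d \<le> v 0 - v n"
  using assms
proof (induction n)
  case (Suc n)
  have "{k. k < Suc n \<and> P k} = (if P n then insert n {k. k < n \<and> P k} else {k. k < n \<and> P k})"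
    by (auto simp: less_Suc_eq)
  then have "real (card {k. k < Suc n \<and> P k}) * d
      = real (card {k. k < n \<and> P k}) * d + (if P n then d else 0)"
    by (simp add: algebra_simps)
  with Suc.IH Suc.prems[of n] Suc.prems show ?case by fastforce
qed simp

theorem theorem4p6:
  fixes f :: "real ^ 'n \<Rightarrow> real"
    and f_low \<alpha> L0 L1 b0 b1 \<kappa> \<eta>1 \<eta>2 \<gamma>1 \<gamma>2 \<gamma>3 \<Delta>0 \<epsilon> \<kappa>0 :: real
    and x0 :: "real ^ 'n"
    and x s :: "nat \<Rightarrow> real ^ 'n"
    and \<Delta> :: "nat \<Rightarrow> real"
    and B :: "nat \<Rightarrow> real ^ 'n ^ 'n"
  assumes "C1 f"
    and "bdd_below (range f)" and "f_low = Inf (range f)"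
    and "0 \<le> \<alpha>" and "\<alpha> \<le> 1" and "0 \<le> L0" and "0 \<le> L1" and "L0 > 0 \<or> L1 > 0"
    and "alpha_smooth \<alpha> L0 L1 f"
    and "tr_constants \<kappa> \<eta>1 \<eta>2 \<gamma>1 \<gamma>2 \<gamma>3" and "\<Delta>0 > 0"
    and "tr_run f \<kappa> \<eta>1 \<eta>2 \<gamma>1 \<gamma>2 \<gamma>3 x0 \<Delta>0 x \<Delta> B s"
    and "0 \<le> b0" and "0 \<le> b1" and "b0 \<le> L0" and "b1 \<le> L1"
    and "\<And>k. matrix_norm (B k) \<le> b0 + b1 * rpow (norm (grad f (x k))) \<alpha>"
    and "infinite {k. successful f \<eta>1 x B s k}"
    and "0 < \<epsilon>" and "\<epsilon> < 1" and "norm (grad f x0) > \<epsilon>"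
    and "\<kappa>0 = (f x0 - f_low)
              / (\<eta>1 * \<kappa>^2 * (1 - \<eta>2) * theta_min \<alpha> L0 L1 f \<kappa> \<eta>2 \<gamma>1 x0 \<Delta>0)"
  shows "(\<exists>k. crosses f x \<epsilon> k) \<and>
    real (card (successful_before f \<eta>1 x B s \<epsilon>))
      \<le> L1 * (1 + rpow (\<kappa> * (1 - \<eta>2)) \<alpha>) * \<kappa>0 * \<epsilon> powr (\<alpha> - 2) + L0 * \<kappa>0 * \<epsilon> powr (-2)"
proof -
  interpret smoothness_constants \<alpha> L0 L1
    by unfold_locales (use assms in auto)
  have const: "0 < \<kappa>" "\<kappa> \<le> 1/2" "0 < \<eta>1" "\<eta>1 \<le> \<eta>2" "\<eta>2 < 1" "0 < \<gamma>1" "\<gamma>1 \<le> \<gamma>2" "\<gamma>2 < 1" "1 \<le> \<gamma>3"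
    using assms(10) by (auto simp: tr_constants_def)
  define b where "b k = norm (grad f (x k))" for k
  define c where "c = \<kappa> * (1 - \<eta>2)"
  define r where "r = safe_radius c \<epsilon>"
  define \<theta> where "\<theta> = theta_min \<alpha> L0 L1 f \<kappa> \<eta>2 \<gamma>1 x0 \<Delta>0"
  \<comment> \<open>The decrease of \<open>f\<close> guaranteed by a successful iteration: \<eta>1
    times the lower bound on the model decrease at radius \<open>\<theta> * r\<close>.\<close>
  define d where "d = \<eta>1 * (\<kappa> * \<epsilon> * (\<theta> * r))"
  have x_0: "x 0 = x0" and \<Delta>_0: "\<Delta> 0 = \<Delta>0"
    and step: "\<And>k. admissible_step f \<kappa> (x k) (B k) (\<Delta> k) (s k)"
    and x_Suc: "\<And>k. x (Suc k) = (if successful f \<eta>1 x B s k then x k + s k else x k)"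
    and \<Delta>_Suc: "\<And>k. let \<rho> = tr_ratio f (x k) (B k) (s k) in
             if \<rho> \<ge> \<eta>2 then \<Delta> (Suc k) \<in> {\<Delta> k .. \<gamma>3 * \<Delta> k}
             else if \<rho> \<ge> \<eta>1 then \<Delta> (Suc k) \<in> {\<gamma>2 * \<Delta> k .. \<Delta> k}
             else \<Delta> (Suc k) \<in> {\<gamma>1 * \<Delta> k .. \<gamma>2 * \<Delta> k}"
    using assms(12) by (auto simp: tr_run_def)
  have BW: "matrix_norm (B k) \<le> W (b k)" for k
  proof -
    have "b1 * rpow (b k) \<alpha> \<le> L1 * rpow (b k) \<alpha>"
      using assms(16) by (rule mult_right_mono) simp
    with assms(15) assms(17)[of k] show ?thesis by (simp add: W_def b_def)
  qed
  have f_low: "f_low \<le> f y" for y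
    using assms(2,3) by (simp add: cInf_lower)
  have c: "0 < c" "c \<le> 1"
    using const by (auto simp: c_def intro: mult_le_one)
  have r: "0 < r" using safe_radius_pos c assms(19) by (simp add: r_def)
  have r_le: "r * G r (b k) \<le> c * (b k / W (b k))" if "\<epsilon> < b k" for k
    using safe_radius_le[of c \<epsilon> "b k"] c assms(19) that by (simp add: r_def)
  have b_0: "\<epsilon> < b 0" using assms(21) by (simp add: b_def x_0)
  define H where "H = aux_h \<alpha> L0 L1 (b 0) (c * (b 0 / W (b 0)))"
  \<comment> \<open>\<open>H\<close> solves with equality the condition that \<open>r\<close>
    satisfies as an inequality at the initial gradient norm.\<close>
  have r_le_H: "r \<le> H"
    unfolding H_def using b_0 r assms(19) r_le by (intro le_aux_h) auto
  have \<theta>_eq: "\<theta> = \<gamma>1 * min 1 (\<Delta>0 / H)"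
    by (simp add: \<theta>_def theta_min_def H_def aux_psi_eq b_def x_0 c_def)
  have \<theta>_pos: "0 < \<theta>"
    using const r r_le_H assms(11) by (simp add: \<theta>_eq)
  have \<theta>_le: "\<theta> \<le> \<gamma>1"
    using mult_left_mono[of "min 1 (\<Delta>0 / H)" 1 \<gamma>1] const by (simp add: \<theta>_eq)
  \<comment> \<open>Base case of the radius bound:
    \<open>\<theta> * r \<le> (\<Delta>0 / H) * H\<close>, using \<open>\<gamma>1 \<le> 1\<close>
    and \<open>r \<le> H\<close>.\<close>
  have "\<theta> \<le> 1 * (\<Delta>0 / H)"
    unfolding \<theta>_eq using const r r_le_H assms(11) by (intro mult_mono) auto
  then have \<theta>_\<Delta>0: "\<theta> * r \<le> \<Delta>0"
    using mult_mono[of \<theta> "\<Delta>0 / H" r H] r r_le_H \<theta>_pos assms(11) by simp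
  \<comment> \<open>A radius at most \<open>r\<close> makes the iteration very successful and so
    does not shrink; a radius above \<open>r\<close> shrinks at most by the factor \<gamma>1, and
    \<open>\<theta> \<le> \<gamma>1\<close>.\<close>
  have radius: "\<theta> * r \<le> \<Delta> k" if "\<And>j. j \<le> k \<Longrightarrow> \<epsilon> < b j" for k
    using that
  proof (induction k)
    case 0
    then show ?case using \<theta>_\<Delta>0 by (simp add: \<Delta>_0)
  next
    case (Suc k)
    then have IH: "\<theta> * r \<le> \<Delta> k" and bk: "\<epsilon> < b k" by simp_all
    have "0 < \<theta> * r" using \<theta>_pos r by simp
    with IH have \<Delta>k: "0 < \<Delta> k" by linarith
    show ?case
    proof (cases "\<Delta> k \<le> r")
      case True
      then have "\<Delta> k * G (\<Delta> k) (b k) \<le> r * G r (b k)"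
        using mult_G_strict_mono[of "\<Delta> k" r "b k"] \<Delta>k bk assms(19) by (cases "\<Delta> k = r") auto
      also have "\<dots> \<le> \<kappa> * (1 - \<eta>2) * (b k / W (b k))" using r_le[OF bk] by (simp add: c_def)
      finally have "\<eta>2 \<le> tr_ratio f (x k) (B k) (s k)"
        using const bk assms(19) BW[of k] \<Delta>k
        by (intro tr_ratio_ge[OF assms(1,9) step]) (auto simp: b_def)
      then show ?thesis using \<Delta>_Suc[of k] IH by (simp add: Let_def)
    next
      case False
      have "\<gamma>1 * \<Delta> k \<le> \<gamma>2 * \<Delta> k" "\<gamma>2 * \<Delta> k \<le> 1 * \<Delta> k"
        using const \<Delta>k by (intro mult_right_mono; simp)+
      then have "\<gamma>1 * \<Delta> k \<le> \<Delta> (Suc k)"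
        using \<Delta>_Suc[of k] by (auto simp: Let_def split: if_splits)
      moreover have "\<theta> * r \<le> \<gamma>1 * \<Delta> k"
        using \<theta>_le False r const \<theta>_pos by (intro mult_mono) auto
      ultimately show ?thesis by linarith
    qed
  qed
  have d: "0 < d" using const assms(19) \<theta>_pos r by (simp add: d_def)
  have decrease: "f (x (Suc k)) \<le> f (x k) - (if successful f \<eta>1 x B s k then d else 0)"
    if "\<And>j. j \<le> k \<Longrightarrow> \<epsilon> < b j" for k
  proof (cases "successful f \<eta>1 x B s k")
    case True
    have bk: "\<epsilon> < b k" using that by simp
    \<comment> \<open>As \<open>G \<ge> 1\<close> and \<open>c \<le> 1\<close>, the radius
      \<open>r\<close> is below \<open>b k / W (b k)\<close>; hence \<open>\<theta> * r\<close> is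
      below both arguments of the minimum in the model decrease.\<close>
    have "r * 1 \<le> r * G r (b k)"
      using r bk assms(19) G_ge_1[of "b k" r] by (intro mult_left_mono) auto
    also have "\<dots> \<le> c * (b k / W (b k))" by (rule r_le[OF bk])
    also have "\<dots> \<le> 1 * (b k / W (b k))"
      using c W_pos[of "b k"] bk assms(19) by (intro mult_right_mono) auto
    finally have "r \<le> b k / W (b k)" by simp
    moreover have "\<theta> * r \<le> 1 * r"
      using \<theta>_le const r by (intro mult_right_mono) auto
    ultimately have "\<theta> * r \<le> min (b k / W (b k)) (\<Delta> k)"
      using radius[OF that] by simp
    then have "\<kappa> * \<epsilon> * (\<theta> * r) \<le> \<kappa> * b k * min (b k / W (b k)) (\<Delta> k)"
      using bk const assms(19) \<theta>_pos r by (intro mult_mono) auto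
    also have "\<dots> \<le> model_decrease f (x k) (B k) (s k)"
      unfolding b_def
    proof (rule model_decrease_ge[OF step])
      show "0 < norm (grad f (x k))" using bk assms(19) unfolding b_def by linarith
    qed (use BW[of k] const in \<open>simp_all add: b_def\<close>)
    finally have m: "\<kappa> * \<epsilon> * (\<theta> * r) \<le> model_decrease f (x k) (B k) (s k)" .
    moreover have "0 < \<kappa> * \<epsilon> * (\<theta> * r)" using const assms(19) \<theta>_pos r by simp
    ultimately have "0 < model_decrease f (x k) (B k) (s k)" by linarith
    with True have "\<eta>1 * model_decrease f (x k) (B k) (s k) \<le> f (x k) - f (x k + s k)"
      by (simp add: successful_def tr_ratio_def le_divide_eq)
    moreover have "d \<le> \<eta>1 * model_decrease f (x k) (B k) (s k)"
      unfolding d_def using m const by (intro mult_left_mono) auto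
    ultimately show ?thesis using True by (simp add: x_Suc)
  qed (simp add: x_Suc)
  have count: "real (card {k. k < n \<and> successful f \<eta>1 x B s k}) * d \<le> f x0 - f_low"
    if "\<And>j. j < n \<Longrightarrow> \<epsilon> < b j" for n
    using card_mult_decrease_le[of n "\<lambda>k. f (x k)" "successful f \<eta>1 x B s" d] decrease that f_low[of "x n"]
    by (force simp: x_0)
  \<comment> \<open>The gradient norm starts above \<epsilon>, and the first passage to a value at
    most \<epsilon> would be a crossing.\<close>
  have above: "\<epsilon> < b j" if "\<And>i. i < j \<Longrightarrow> \<not> crosses f x \<epsilon> i" for j
    using that
  proof (induction j)
    case (Suc j)
    then have "\<epsilon> < b j" by simp
    with Suc.prems[of j] show ?case by (simp add: crosses_def b_def)
  qed (rule b_0)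
  have crossing: "\<exists>k. crosses f x \<epsilon> k"
  proof (rule ccontr)
    assume no: "\<nexists>k. crosses f x \<epsilon> k"
    \<comment> \<open>Without a crossing every successful iteration would gain \<open>d\<close>.
      Choosing \<open>N\<close> successes with \<open>N * d\<close> beyond the total possible
      decrease contradicts the lower bound of \<open>f\<close>; so the least element in
      \<open>k_first\<close> exists.\<close>
    obtain N where N: "f x0 - f_low < real N * d"
      using reals_Archimedean3[OF d] by blast
    obtain F where F: "finite F" "card F = N" "F \<subseteq> {k. successful f \<eta>1 x B s k}"
      using infinite_arbitrarily_large[OF assms(18)] by blast
    obtain n where "F \<subseteq> {..<n}" using F(1) finite_nat_iff_bounded by blast
    then have "N \<le> card {k. k < n \<and> successful f \<eta>1 x B s k}"
      unfolding F(2)[symmetric] using F(3) by (intro card_mono) auto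
    then have "real N * d \<le> real (card {k. k < n \<and> successful f \<eta>1 x B s k}) * d"
      using d by (intro mult_right_mono) auto
    with count[of n] above no N show False by force
  qed
  define S where "S = successful_before f \<eta>1 x B s \<epsilon>"
  define w where "w = L0 + L1 * (1 + rpow c \<alpha>) * \<epsilon> powr \<alpha>"
  have "real (card S) * d \<le> f x0 - f_low"
    unfolding S_def successful_before_def
  proof (rule count)
    fix j assume "j < k_first f x \<epsilon>"
    then show "\<epsilon> < b j"
      unfolding k_first_def by (intro above not_less_Least) simp
  qed
  moreover have d_eq: "d = \<eta>1 * \<kappa> * \<epsilon>\<^sup>2 * \<theta> * c / w"
    using assms(19) by (simp add: d_def r_def safe_radius_def w_def power2_eq_square)
  \<comment> \<open>The sign of \<open>w\<close> is read off from \<open>d > 0\<close> and the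
    positive numerator in \<open>d_eq\<close>.\<close>
  moreover have "0 < w"
  proof -
    have "0 < \<eta>1 * \<kappa> * \<epsilon>\<^sup>2 * \<theta> * c"
      using assms(19) const \<theta>_pos c by simp
    with d show ?thesis unfolding d_eq zero_less_divide_iff by linarith
  qed
  ultimately have "real (card S) \<le> (f x0 - f_low) / (\<eta>1 * \<kappa> * \<theta> * c) * w / \<epsilon>\<^sup>2"
    using assms(19) const \<theta>_pos c by (simp add: divide_simps mult_ac)
  \<comment> \<open>Unfolding \<open>c = \<kappa> * (1 - \<eta>2)\<close> supplies the second factor
    \<kappa> in the denominator of \<kappa>0. One power of \<epsilon> comes from the gradient bound,
    the other from \<open>r\<close>.\<close>
  also have "\<dots> = \<kappa>0 * w * \<epsilon> powr (-2)"
    using assms(19) by (simp add: assms(22) \<theta>_def c_def power2_eq_square powr_minus divide_simps mult_ac)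
  also have "\<dots> = L1 * (1 + rpow c \<alpha>) * \<kappa>0 * \<epsilon> powr (\<alpha> - 2) + L0 * \<kappa>0 * \<epsilon> powr (-2)"
    using assms(19) powr_add[of \<epsilon> \<alpha> "-2"] by (simp add: w_def algebra_simps)
  finally show ?thesis
    using crossing by (simp add: S_def c_def)
qed

end
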